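(* Let $X\in\mathbb{R}^{n\times n}_+$. Then there is a unique matrix $SK^{(X)}\in\mathbb{R}^{n\times n}$ such that, for all balancing vectors $\mathbf r,\mathbf c\in\mathbb{R}^n_+$ of $X$ (that is, vectors such that $D_{(\mathbf r)}XD_{(\mathbf c)}$ is doubly stochastic), $$\mathcal{P}_{sk}(X)=X\circ SK^{(X)}=X\circ(\mathbf r\otimes\mathbf c^T).$$
   Context: $\mathbb{R}^{n\times n}_+$ (resp. $\mathbb{R}^n_+$) denotes the real $n\times n$ matrices (resp. $n$-vectors) with all entries strictly positive. For a vector $\mathbf{x}$, $D_{(\mathbf{x})}$ is the diagonal matrix with diagonal $\mathbf{x}$. A matrix is doubly stochastic if it is entrywise nonnegative with all row sums and all column sums equal to $1$. $\circ$ is the Hadamard (entrywise) product. For vectors $\mathbf r,\mathbf c\in\mathbb{R}^n$, $\mathbf r\otimes\mathbf c^T$ is the $n\times n$ matrix with entries $(\mathbf r\otimes\mathbf c^T)_{ij}=r_ic_j$. Sinkhorn operator: for $X\in\mathbb{R}^{n\times n}_+$, $\mathcal{P}_{sk}(X)=D_{(\mathbf r)}XD_{(\mathbf c)}$, where $\mathbf r,\mathbf c\in\mathbb{R}^n_+$ are balancing vectors, i.e. such that $D_{(\mathbf r)}XD_{(\mathbf c)}$ is doubly stochastic (by Sinkhorn's theorem such vectors exist and the resulting doubly stochastic matrix is unique). *)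

theory Defs
  imports "HOL-Analysis.Analysis"
begin

definition positive_vec :: "real ^ 'n \<Rightarrow> bool" where
  "positive_vec x \<longleftrightarrow> (\<forall>i. x $ i > 0)"

definition positive_mat :: "real ^ 'n ^ 'n \<Rightarrow> bool" where
  "positive_mat X \<longleftrightarrow> (\<forall>i j. X $ i $ j > 0)"

definition diag_mat :: "real ^ 'n \<Rightarrow> real ^ 'n ^ 'n" where
  "diag_mat x = (\<chi> i j. if i = j then x $ i else 0)"

definition doubly_stochastic :: "real ^ 'n ^ 'n \<Rightarrow> bool" where
  "doubly_stochastic A \<longleftrightarrow>
     (\<forall>i j. A $ i $ j \<ge> 0) \<and>
     (\<forall>i. (\<Sum>j\<in>UNIV. A $ i $ j) = 1) \<and>
     (\<forall>j. (\<Sum>i\<in>UNIV. A $ i $ j) = 1)"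

definition hadamard :: "real ^ 'n ^ 'n \<Rightarrow> real ^ 'n ^ 'n \<Rightarrow> real ^ 'n ^ 'n" (infixl "\<circ>\<^sub>H" 70) where
  "A \<circ>\<^sub>H B = (\<chi> i j. A $ i $ j * B $ i $ j)"

definition outer_prod :: "real ^ 'n \<Rightarrow> real ^ 'n \<Rightarrow> real ^ 'n ^ 'n" where
  "outer_prod r c = (\<chi> i j. r $ i * c $ j)"

definition balancing :: "real ^ 'n ^ 'n \<Rightarrow> real ^ 'n \<Rightarrow> real ^ 'n \<Rightarrow> bool" where
  "balancing X r c \<longleftrightarrow>
     positive_vec r \<and> positive_vec c \<and> doubly_stochastic (diag_mat r ** X ** diag_mat c)"

text \<open>
  Balancing vectors are determined only up to a scaling \<open>(t r, c / t)\<close>, so the operator is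
  given by description of the scaled matrix, which does not depend on their choice. The value is
  meaningful for entrywise positive matrices; for those, Sinkhorn's theorem provides existence and
  uniqueness.
\<close>

definition sinkhorn :: "real ^ 'n ^ 'n \<Rightarrow> real ^ 'n ^ 'n" where
  "sinkhorn X = (THE P. \<exists>r c. balancing X r c \<and> P = diag_mat r ** X ** diag_mat c)"

end

theory Submission
  imports Defs
begin

text \<open>
  Existence of balancing vectors: with \<open>T\<^sub>j(c) = 1 / (\<Sum>i. X\<^sub>i\<^sub>j / (Xc)\<^sub>i)\<close>, Brouwer's theorem applied to the
  map \<open>c \<mapsto> T(c) / (\<Sum>j. T\<^sub>j(c))\<close> on the standard simplex gives a positive \<open>c\<close> with
  \<open>c\<^sub>j (\<Sum>i. X\<^sub>i\<^sub>j / (Xc)\<^sub>i)\<close> independent of \<open>j\<close>. Summing over \<open>j\<close> shows that this constant is \<open>1\<close>, so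
  \<open>r\<^sub>i = 1 / (Xc)\<^sub>i\<close> and \<open>c\<close> balance \<open>X\<close>.

  Uniqueness: if \<open>(r, c)\<close> and \<open>(r', c')\<close> balance \<open>X\<close>, put \<open>a\<^sub>i = r'\<^sub>i / r\<^sub>i\<close> and \<open>b\<^sub>j = c'\<^sub>j / c\<^sub>j\<close>. At an
  index \<open>M\<close> maximising \<open>a\<close>, the column sums give \<open>a\<^sub>M b\<^sub>j \<ge> 1\<close> for all \<open>j\<close>; the row sum at \<open>M\<close> forces
  equality, and the column sums then force \<open>a\<close> to be constant. Hence \<open>r \<otimes> c\<^sup>T\<close> depends only on \<open>X\<close>,
  and, the entries of \<open>X\<close> being nonzero, it is the only possible \<open>SK\<close>.
\<close>

lemma diag_mat_scaling:
  "diag_mat r ** X ** diag_mat c = X \<circ>\<^sub>H outer_prod r c"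
  by (simp add: vec_eq_iff matrix_matrix_mult_def diag_mat_def hadamard_def outer_prod_def
      if_distrib if_distribR mult_ac cong: if_cong)

lemma balancing_iff:
  assumes "positive_mat X"
  shows "balancing X r c \<longleftrightarrow> positive_vec r \<and> positive_vec c \<and>
    (\<forall>i. (\<Sum>j\<in>UNIV. X $ i $ j * (r $ i * c $ j)) = 1) \<and>
    (\<forall>j. (\<Sum>i\<in>UNIV. X $ i $ j * (r $ i * c $ j)) = 1)"
  using assms
  by (auto simp: balancing_def diag_mat_scaling doubly_stochastic_def hadamard_def outer_prod_def
      positive_vec_def positive_mat_def intro!: mult_nonneg_nonneg less_imp_le)

lemma hadamard_left_cancel:
  assumes "positive_mat X" "X \<circ>\<^sub>H A = X \<circ>\<^sub>H B"
  shows "A = B"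
  using assms unfolding hadamard_def positive_mat_def vec_eq_iff
  by (simp add: less_le)

text \<open>The deviations \<open>x j - 1\<close> all have one sign and their weighted sum vanishes;
  positive weights then make each of them zero.\<close>

lemma weighted_sum_eq_1_imp_eq_1:
  fixes w x :: "'n :: finite \<Rightarrow> real"
  assumes w: "\<And>j. w j > 0" "(\<Sum>j\<in>UNIV. w j) = 1"
    and x: "(\<forall>j. x j \<ge> 1) \<or> (\<forall>j. x j \<le> 1)" "(\<Sum>j\<in>UNIV. w j * x j) = 1"
  shows "x j = 1"
proof -
  have z: "(\<Sum>j\<in>UNIV. w j * (x j - 1)) = 0"
    using w(2) x(2) by (simp add: algebra_simps sum_subtractf)
  then have z': "(\<Sum>j\<in>UNIV. w j * (1 - x j)) = 0"
    using w(2) x(2) by (simp add: algebra_simps sum_subtractf)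
  show ?thesis
    using x(1)
  proof
    assume "\<forall>j. x j \<ge> 1"
    then show ?thesis
      using z w(1) by (subst (asm) sum_nonneg_eq_0_iff) (auto simp: less_le)
  next
    assume "\<forall>j. x j \<le> 1"
    then show ?thesis
      using z' w(1) by (subst (asm) sum_nonneg_eq_0_iff) (auto simp: less_le)
  qed
qed

lemma balancing_outer_prod_unique:
  fixes X :: "real ^ 'n ^ 'n"
  assumes X: "positive_mat X" and rc: "balancing X r c" and rc': "balancing X r' c'"
  shows "outer_prod r c = outer_prod r' c'"
proof -
  \<comment> \<open>The first scaling provides weights: the rows and columns of \<open>A\<close> sum
    to 1, and rescaling \<open>A\<close> by \<open>a\<close> and \<open>b\<close> gives the second
    scaling.\<close>
  define A where "A i j = X $ i $ j * (r $ i * c $ j)" for i j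
  define a where "a i = r' $ i / r $ i" for i
  define b where "b j = c' $ j / c $ j" for j
  have pos: "r $ i > 0" "c $ i > 0" "r' $ i > 0" "c' $ i > 0" "X $ i $ j > 0" for i j
    using assms by (auto simp: balancing_def positive_vec_def positive_mat_def)
  have A_pos: "A i j > 0" and a_pos: "a i > 0" and b_pos: "b j > 0" for i j
    using pos by (simp_all add: A_def a_def b_def)
  have A_row: "(\<Sum>j\<in>UNIV. A i j) = 1" and A_col: "(\<Sum>i\<in>UNIV. A i j) = 1" for i j
    using rc X by (simp_all add: balancing_iff A_def)
  have A_scaled: "A i j * (a i * b j) = X $ i $ j * (r' $ i * c' $ j)" for i j
    using pos(1)[of i] pos(2)[of j] by (simp add: A_def a_def b_def field_simps)
  have row: "(\<Sum>j\<in>UNIV. A i j * (a i * b j)) = 1"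
    and col: "(\<Sum>i\<in>UNIV. A i j * (a i * b j)) = 1" for i j
    using rc' X by (simp_all add: balancing_iff A_scaled)
  have "Max (range a) \<in> range a"
    by (intro Max_in) auto
  then obtain M where M: "a M = Max (range a)"
    by (metis imageE)
  have a_le: "a i \<le> a M" for i
    unfolding M by (intro Max_ge) auto
  have ge: "a M * b j \<ge> 1" for j
  proof -
    \<comment> \<open>Replacing each \<open>a i\<close> by the maximum can only raise the column
      sum, which is 1.\<close>
    have "1 \<le> (\<Sum>i\<in>UNIV. A i j * (a M * b j))"
      unfolding col[of j, symmetric]
      using A_pos b_pos a_le by (intro sum_mono mult_left_mono mult_right_mono) (auto simp: less_imp_le)
    also have "\<dots> = a M * b j"
      by (simp add: sum_distrib_right[symmetric] A_col)
    finally show ?thesis .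
  qed
  have M_eq: "a M * b j = 1" for j
    using weighted_sum_eq_1_imp_eq_1[of "A M" "\<lambda>j. a M * b j"] A_pos A_row ge row by blast
  have "a i * b j \<le> 1" for i j
    using mult_right_mono[OF a_le[of i], of "b j"] b_pos[of j] M_eq[of j] by simp
  then have "a i * b j = 1" for i j
    using weighted_sum_eq_1_imp_eq_1[of "\<lambda>i. A i j" "\<lambda>i. a i * b j"] A_pos A_col col by blast
  then have "r $ i * c $ j = r' $ i * c' $ j" for i j
    using pos(1)[of i] pos(2)[of j] by (simp add: a_def b_def field_simps)
  then show ?thesis
    by (simp add: outer_prod_def)
qed

lemma balancing_exists:
  fixes X :: "real ^ 'n ^ 'n"
  assumes X: "positive_mat X"
  shows "\<exists>r c. balancing X r c"
proof -
  define S :: "(real ^ 'n) set" where "S = {c. (\<forall>j. c $ j \<ge> 0) \<and> (\<Sum>j\<in>UNIV. c $ j) = 1}"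
  define y where "y c i = (\<Sum>j\<in>UNIV. X $ i $ j * c $ j)" for c :: "real ^ 'n" and i
  define T where "T c j = 1 / (\<Sum>i\<in>UNIV. X $ i $ j / y c i)" for c j
  define f :: "real ^ 'n \<Rightarrow> real ^ 'n" where "f c = (\<chi> j. T c j / (\<Sum>k\<in>UNIV. T c k))" for c
  have X_pos: "X $ i $ j > 0" for i j
    using X by (simp add: positive_mat_def)
  \<comment> \<open>Points of \<open>S\<close> may have zero coordinates, but not all are zero. As
    \<open>X\<close> is entrywise positive, no denominator vanishes even on the boundary of the
    simplex.\<close>
  have y_pos: "y c i > 0" if "c \<in> S" for c i
  proof -
    have "\<exists>j. c $ j > 0"
    proof (rule ccontr)
      assume "\<not> ?thesis"
      then have "(\<Sum>j\<in>UNIV. c $ j) \<le> 0"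
        by (intro sum_nonpos) (simp add: not_less)
      then show False
        using that by (simp add: S_def)
    qed
    then obtain j where "c $ j > 0" ..
    then show ?thesis
      unfolding y_def using that X_pos
      by (intro sum_pos2[of _ j]) (auto simp: S_def less_imp_le)
  qed
  have w_pos: "(\<Sum>i\<in>UNIV. X $ i $ j / y c i) > 0" if "c \<in> S" for c j
    using y_pos[OF that] X_pos by (intro sum_pos) auto
  have T_pos: "T c j > 0" if "c \<in> S" for c j
    using w_pos[OF that] by (simp add: T_def)
  have sum_T_pos: "(\<Sum>k\<in>UNIV. T c k) > 0" if "c \<in> S" for c
    using T_pos[OF that] by (intro sum_pos) auto
  have "compact S"
  proof -
    have "S = (\<Inter>j. {c. c $ j \<ge> 0}) \<inter> {c. (\<Sum>j\<in>UNIV. c $ j) = 1}"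
      by (auto simp: S_def)
    moreover have "closed \<dots>"
      by (intro closed_Int closed_INT ballI closed_Collect_le closed_Collect_eq continuous_intros)
    moreover have "norm c \<le> 1" if "c \<in> S" for c
      using norm_le_l1_cart[of c] that by (simp add: S_def)
    then have "bounded S"
      by (auto simp: bounded_iff)
    ultimately show ?thesis
      by (simp add: compact_eq_bounded_closed)
  qed
  moreover have "convex S"
    by (auto simp: convex_def S_def sum.distrib sum_distrib_left[symmetric])
  moreover have "axis undefined 1 \<in> S"
    by (auto simp: S_def axis_def)
  then have "S \<noteq> {}"
    by blast
  moreover have "continuous_on S f"
  proof -
    have y_cont: "continuous_on S (\<lambda>c. y c i)" for i
      unfolding y_def by (intro continuous_intros)
    have "continuous_on S (\<lambda>c. T c j)" for j
      unfolding T_def using w_pos y_pos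
      by (intro continuous_intros y_cont) (auto simp: less_imp_neq[THEN not_sym])
    then show ?thesis
      unfolding f_def using sum_T_pos
      by (intro continuous_intros) (auto simp: less_imp_neq[THEN not_sym])
  qed
  moreover have "f \<in> S \<rightarrow> S"
    using T_pos sum_T_pos
    by (auto simp: S_def f_def sum_divide_distrib[symmetric] less_imp_le less_imp_neq[THEN not_sym])
  ultimately obtain c where c: "c \<in> S" "f c = c"
    using brouwer[of S f] by blast
  define t where "t = (\<Sum>k\<in>UNIV. T c k)"
  have t_pos: "t > 0"
    using sum_T_pos[OF c(1)] by (simp add: t_def)
  have c_eq: "c $ j = T c j / t" for j
    using c(2) by (metis f_def t_def vec_lambda_beta)
  \<comment> \<open>Values of \<open>f\<close> on \<open>S\<close> are entrywise positive, so the
    fixed point lies off the boundary.\<close>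
  have c_pos: "c $ j > 0" for j
    using T_pos[OF c(1)] t_pos by (simp add: c_eq)
  define r where "r = (\<chi> i. 1 / y c i)"
  have row: "(\<Sum>j\<in>UNIV. X $ i $ j * (r $ i * c $ j)) = 1" for i
  proof -
    have "(\<Sum>j\<in>UNIV. X $ i $ j * (r $ i * c $ j)) = y c i / y c i"
      by (simp add: r_def sum_divide_distrib[symmetric] flip: y_def)
    then show ?thesis
      using y_pos[OF c(1), of i] by simp
  qed
  have col: "(\<Sum>i\<in>UNIV. X $ i $ j * (r $ i * c $ j)) = 1 / t" for j
  proof -
    have "(\<Sum>i\<in>UNIV. X $ i $ j * (r $ i * c $ j)) = (\<Sum>i\<in>UNIV. X $ i $ j / y c i) * c $ j"
      by (simp add: r_def sum_distrib_right)
    also have "\<dots> = 1 / t"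
      using w_pos[OF c(1), of j] by (simp add: c_eq T_def)
    finally show ?thesis .
  qed
  \<comment> \<open>Double counting of the total mass: each row contributes 1, each column
    \<open>1 / t\<close>.\<close>
  have "real CARD('n) = (\<Sum>i\<in>UNIV. \<Sum>j\<in>UNIV. X $ i $ j * (r $ i * c $ j))"
    by (simp add: row)
  also have "\<dots> = real CARD('n) * (1 / t)"
    by (subst sum.swap) (simp add: col)
  finally have "t = 1"
    using t_pos by (simp add: field_simps)
  then have "balancing X r c"
    using X row col c_pos y_pos[OF c(1)] by (simp add: balancing_iff positive_vec_def r_def)
  then show ?thesis
    by blast
qed

text \<open>All balancing pairs share one outer product, so the description defining
  \<open>sinkhorn\<close> has exactly one candidate.\<close>

lemma sinkhorn_eq:
  assumes "positive_mat X" "balancing X r c"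
  shows "sinkhorn X = X \<circ>\<^sub>H outer_prod r c"
  unfolding sinkhorn_def diag_mat_scaling
proof (rule the_equality)
  show "\<exists>r' c'. balancing X r' c' \<and> X \<circ>\<^sub>H outer_prod r c = X \<circ>\<^sub>H outer_prod r' c'"
    using assms(2) by blast
  show "P = X \<circ>\<^sub>H outer_prod r c"
    if "\<exists>r c. balancing X r c \<and> P = X \<circ>\<^sub>H outer_prod r c" for P
    using that balancing_outer_prod_unique[OF assms] by auto
qed

theorem proposition3:
  fixes X :: "real ^ 'n ^ 'n"
  assumes "positive_mat X"
  shows "\<exists>!SK :: real ^ 'n ^ 'n.
           \<forall>r c. balancing X r c \<longrightarrow>
             sinkhorn X = X \<circ>\<^sub>H SK \<and> X \<circ>\<^sub>H SK = X \<circ>\<^sub>H outer_prod r c"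
proof -
  \<comment> \<open>Uniqueness of \<open>SK\<close> rests on this pair: if there were none, the
    condition would hold vacuously for every matrix.\<close>
  obtain r c where rc: "balancing X r c"
    using balancing_exists[OF assms] by blast
  show ?thesis
  proof (rule ex1I)
    show "\<forall>r' c'. balancing X r' c' \<longrightarrow>
      sinkhorn X = X \<circ>\<^sub>H outer_prod r c \<and> X \<circ>\<^sub>H outer_prod r c = X \<circ>\<^sub>H outer_prod r' c'"
      using sinkhorn_eq[OF assms] rc by metis
  next
    fix SK
    assume "\<forall>r c. balancing X r c \<longrightarrow>
      sinkhorn X = X \<circ>\<^sub>H SK \<and> X \<circ>\<^sub>H SK = X \<circ>\<^sub>H outer_prod r c"
    then show "SK = outer_prod r c"
      using rc hadamard_left_cancel[OF assms] by blast
  qed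
qed

end
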